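(* Let $p\in\,]0,1[$, and let $\theta'$ be a non-atomic distribution on $\mathbb{R}_+$ whose support does not contain $0$. Then the distribution $\theta=p\cdot\delta_0+(1-p)\cdot\theta'$ is not feasible.
   Context: Notation: $\mathbb{R}_+=[0,\infty[$, $]0,1[$ is the open unit interval, and $\delta_0$ is the Dirac mass at $0$. A distribution on $\mathbb{R}_+$ is a Borel probability measure on $\mathbb{R}_+$; it is non-atomic if it assigns mass $0$ to every single point. A distribution $\theta$ on $\mathbb{R}_+$ is called feasible if there exist a complete separable metric space $(S,d)$ and a Borel probability measure $\mu$ on $S$ such that, for $\xi_1,\xi_2$ independent random variables with distribution $\mu$, the random variable $d(\xi_1,\xi_2)$ has distribution $\theta$. *)

theory Defs
  imports "HOL-Probability.Probability"
begin

definition nonneg_borel :: "real measure"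
  where "nonneg_borel = restrict_space borel {0..}"

definition nonneg_distribution :: "real measure \<Rightarrow> bool"
  where "nonneg_distribution \<theta> \<longleftrightarrow> prob_space \<theta> \<and> sets \<theta> = sets nonneg_borel"

definition nonatomic :: "real measure \<Rightarrow> bool"
  where "nonatomic \<theta> \<longleftrightarrow> (\<forall>x \<in> space \<theta>. emeasure \<theta> {x} = 0)"

text \<open>The relatively open neighbourhoods of a point of \<^term>\<open>space M\<close> are the sets
  \<^term>\<open>U \<inter> space M\<close> with \<^term>\<open>U\<close> open.\<close>

definition msupport :: "'a::topological_space measure \<Rightarrow> 'a set"
  where "msupport M = {x \<in> space M. \<forall>U. open U \<and> x \<in> U \<longrightarrow> emeasure M (U \<inter> space M) > 0}"

text \<open>The measure \<open>p \<cdot> M + (1 - p) \<cdot> N\<close>.\<close>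

definition mixture :: "real \<Rightarrow> 'a measure \<Rightarrow> 'a measure \<Rightarrow> 'a measure"
  where "mixture p M N = measure_of (space M) (sets M)
           (\<lambda>A. ennreal p * emeasure M A + ennreal (1 - p) * emeasure N A)"

lemma space_mixture [simp]: "space (mixture p M N) = space M"
  by (simp add: mixture_def space_measure_of_conv)

lemma sets_mixture [simp, measurable_cong]: "sets (mixture p M N) = sets M"
  by (simp add: mixture_def)

lemma emeasure_mixture:
  assumes "sets N = sets M" and A: "A \<in> sets M"
  shows "emeasure (mixture p M N) A
           = ennreal p * emeasure M A + ennreal (1 - p) * emeasure N A"
proof (rule emeasure_measure_of[OF mixture_def])
  show "sets M \<subseteq> Pow (space M)"
    by (rule sets.space_closed)
  show "positive (sets (mixture p M N))
          (\<lambda>A. ennreal p * emeasure M A + ennreal (1 - p) * emeasure N A)"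
    by (simp add: positive_def)
  show "countably_additive (sets (mixture p M N))
          (\<lambda>A. ennreal p * emeasure M A + ennreal (1 - p) * emeasure N A)"
    using assms(1)
    by (auto simp: countably_additive_def suminf_add[symmetric] suminf_emeasure ennreal_suminf_cmult)
qed (use A in simp)

text \<open>The Borel \<open>\<sigma>\<close>-algebra of a metric space that is given by a carrier set and a metric.\<close>

definition metric_borel :: "'a set \<Rightarrow> ('a \<Rightarrow> 'a \<Rightarrow> real) \<Rightarrow> 'a measure"
  where "metric_borel S d = sigma S {U. openin (Metric_space.mtopology S d) U}"

definition polish_metric :: "'a set \<Rightarrow> ('a \<Rightarrow> 'a \<Rightarrow> real) \<Rightarrow> bool"
  where "polish_metric S d \<longleftrightarrow> Metric_space S d \<and> Metric_space.mcomplete S d \<and>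
           separable_space (Metric_space.mtopology S d)"

text \<open>The distribution of \<open>d(\<xi>\<^sub>1, \<xi>\<^sub>2)\<close> for independent \<open>\<xi>\<^sub>1\<close>, \<open>\<xi>\<^sub>2\<close> with distribution \<^term>\<open>\<mu>\<close>;
  see \<open>distr_distance_indep\<close> below.\<close>

definition distance_distribution :: "('a \<Rightarrow> 'a \<Rightarrow> real) \<Rightarrow> 'a measure \<Rightarrow> real measure"
  where "distance_distribution d \<mu> = distr (\<mu> \<Otimes>\<^sub>M \<mu>) nonneg_borel (\<lambda>(x, y). d x y)"

text \<open>HOL cannot quantify over types inside a formula, so the type from which the points of the
  metric space are taken is a parameter; the space itself is an arbitrary subset \<^term>\<open>S\<close> of it.
  That \<open>\<theta>\<close> is not feasible means \<open>\<not> feasible TYPE('a) \<theta>\<close> for every type \<open>'a\<close>.\<close>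

definition feasible :: "'a itself \<Rightarrow> real measure \<Rightarrow> bool"
  where "feasible T \<theta> \<longleftrightarrow>
    (\<exists>(S :: 'a set) d \<mu>. polish_metric S d \<and> prob_space \<mu> \<and>
       sets \<mu> = sets (metric_borel S d) \<and> distance_distribution d \<mu> = \<theta>)"

lemma space_metric_borel:
  assumes "Metric_space S d"
  shows "space (metric_borel S d) = S"
proof -
  interpret Metric_space S d by fact
  show ?thesis
    unfolding metric_borel_def using openin_subset[of mtopology]
    by (subst space_measure_of) auto
qed

lemma openin_metric_borel:
  assumes "Metric_space S d" "openin (Metric_space.mtopology S d) U"
  shows "U \<in> sets (metric_borel S d)"
proof -
  interpret Metric_space S d by fact
  show ?thesis
    unfolding metric_borel_def using assms(2) openin_subset[of mtopology]
    by (subst sets_measure_of) auto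
qed

lemma measurable_metric:
  assumes P: "polish_metric S d"
  shows "(\<lambda>(x, y). d x y) \<in> metric_borel S d \<Otimes>\<^sub>M metric_borel S d \<rightarrow>\<^sub>M nonneg_borel"
proof -
  let ?B = "metric_borel S d"
  have M: "Metric_space S d"
    using P by (simp add: polish_metric_def)
  interpret Metric_space S d by fact
  obtain C where C: "countable C" "C \<subseteq> S" "mtopology closure_of C = S"
    using P by (auto simp: polish_metric_def separable_space_def)
  have sp: "space (?B \<Otimes>\<^sub>M ?B) = S \<times> S"
    by (simp add: space_pair_measure space_metric_borel[OF M])
  have ball [measurable]: "mball c r \<in> sets ?B" for c r
    by (rule openin_metric_borel[OF M]) simp
  have "(\<lambda>(x, y). d x y) \<in> borel_measurable (?B \<Otimes>\<^sub>M ?B)"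
  proof (rule borel_measurableI_less)
    fix a :: real
    let ?R = "(\<Union>c\<in>C. \<Union>q\<in>\<rat>. \<Union>r\<in>{r\<in>\<rat>. q + r \<le> a}. mball c q \<times> mball c r)"
    have "{w \<in> space (?B \<Otimes>\<^sub>M ?B). (case w of (x, y) \<Rightarrow> d x y) < a} = ?R"
    proof (intro set_eqI iffI)
      fix w assume "w \<in> {w \<in> space (?B \<Otimes>\<^sub>M ?B). (case w of (x, y) \<Rightarrow> d x y) < a}"
      then obtain x y where w: "w = (x, y)" "x \<in> S" "y \<in> S" "d x y < a"
        by (auto simp: sp)
      define e where "e = (a - d x y) / 4"
      have e: "e > 0" using w by (simp add: e_def)
      obtain c where c: "c \<in> C" "d x c < e"
        using C(3) w(2) e by (auto simp: metric_closure_of set_eq_iff in_mball)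
      have cS: "c \<in> S" using c C by auto
      obtain q where q: "q \<in> \<rat>" "e < q" "q < 2 * e"
        using Rats_dense_in_real[of e "2 * e"] e by auto
      obtain r where r: "r \<in> \<rat>" "d x y + e < r" "r < d x y + 2 * e"
        using Rats_dense_in_real[of "d x y + e" "d x y + 2 * e"] e by auto
      have "d c y \<le> d c x + d x y"
        using cS w by (intro triangle) auto
      moreover have "d c x = d x c"
        by (rule commute)
      moreover have "a = d x y + 4 * e"
        by (simp add: e_def field_simps)
      ultimately have "d c x < q" "d c y < r" "q + r \<le> a"
        using c(2) q r by linarith+
      then show "w \<in> ?R"
        using w cS c q r by (auto simp: in_mball intro!: bexI[of _ c] bexI[of _ q] exI[of _ r])
    next
      fix w assume "w \<in> ?R"
      then obtain x y c q r where w: "w = (x, y)" "c \<in> S" "x \<in> S" "y \<in> S"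
          "d c x < q" "d c y < r" "q + r \<le> a"
        by (auto simp: in_mball)
      have "d x y \<le> d x c + d c y"
        using w by (intro triangle) auto
      then show "w \<in> {w \<in> space (?B \<Otimes>\<^sub>M ?B). (case w of (x, y) \<Rightarrow> d x y) < a}"
        using w commute[of x c] by (auto simp: sp)
    qed
    moreover have "?R \<in> sets (?B \<Otimes>\<^sub>M ?B)"
      using C(1) countable_rat
      by (intro sets.countable_UN'') (auto intro: countable_subset[OF _ countable_rat])
    ultimately show "{w \<in> space (?B \<Otimes>\<^sub>M ?B). (case w of (x, y) \<Rightarrow> d x y) < a} \<in> sets (?B \<Otimes>\<^sub>M ?B)"
      by simp
  qed
  then show ?thesis
    by (auto simp: nonneg_borel_def intro!: measurable_restrict_space2)
qed

lemma distr_distance_indep: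
  assumes P: "polish_metric S d" and \<mu>: "sets \<mu> = sets (metric_borel S d)"
    and \<Omega>: "prob_space \<Omega>"
    and indep: "prob_space.indep_var \<Omega> \<mu> \<xi>\<^sub>1 \<mu> \<xi>\<^sub>2"
    and law: "distr \<Omega> \<mu> \<xi>\<^sub>1 = \<mu>" "distr \<Omega> \<mu> \<xi>\<^sub>2 = \<mu>"
  shows "distr \<Omega> nonneg_borel (\<lambda>\<omega>. d (\<xi>\<^sub>1 \<omega>) (\<xi>\<^sub>2 \<omega>)) = distance_distribution d \<mu>"
proof -
  interpret prob_space \<Omega> by fact
  have rv [measurable]: "\<xi>\<^sub>1 \<in> \<Omega> \<rightarrow>\<^sub>M \<mu>" "\<xi>\<^sub>2 \<in> \<Omega> \<rightarrow>\<^sub>M \<mu>"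
    using indep indep_var_distribution_eq[of \<mu> \<xi>\<^sub>1 \<mu> \<xi>\<^sub>2] by auto
  have joint: "\<mu> \<Otimes>\<^sub>M \<mu> = distr \<Omega> (\<mu> \<Otimes>\<^sub>M \<mu>) (\<lambda>\<omega>. (\<xi>\<^sub>1 \<omega>, \<xi>\<^sub>2 \<omega>))"
    using indep indep_var_distribution_eq[of \<mu> \<xi>\<^sub>1 \<mu> \<xi>\<^sub>2] by (simp add: law)
  have d: "(\<lambda>(x, y). d x y) \<in> \<mu> \<Otimes>\<^sub>M \<mu> \<rightarrow>\<^sub>M nonneg_borel"
    using measurable_metric[OF P] measurable_cong_sets[OF sets_pair_measure_cong[OF \<mu> \<mu>] refl]
    by blast
  have "distance_distribution d \<mu> =
      distr (distr \<Omega> (\<mu> \<Otimes>\<^sub>M \<mu>) (\<lambda>\<omega>. (\<xi>\<^sub>1 \<omega>, \<xi>\<^sub>2 \<omega>))) nonneg_borel (\<lambda>(x, y). d x y)"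
    unfolding distance_distribution_def by (subst joint) (rule refl)
  also have "\<dots> = distr \<Omega> nonneg_borel (\<lambda>\<omega>. d (\<xi>\<^sub>1 \<omega>) (\<xi>\<^sub>2 \<omega>))"
    using d by (subst distr_distr) (auto simp: comp_def)
  finally show ?thesis by simp
qed

end

theory Submission
  imports Defs
begin

text \<open>
  Suppose that \<open>\<theta>\<close> is the distribution of \<open>d(\<xi>\<^sub>1, \<xi>\<^sub>2)\<close> with \<open>\<xi>\<^sub>1, \<xi>\<^sub>2\<close> independent of law \<open>\<mu>\<close>.
  As \<open>0\<close> is outside the support of \<open>\<theta>'\<close>, there is \<open>r > 0\<close> such that almost surely the
  distance is \<open>0\<close> or at least \<open>r\<close>.  Hence for almost every \<open>x\<close> the ball of radius \<open>r\<close> around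
  \<open>x\<close> carries no mass except at \<open>x\<close> itself.  By separability, almost every such ball has
  positive mass, so almost every point is an atom of \<open>\<mu>\<close> (\<open>AE_atom_if_distance_gap\<close>).

  Two atoms \<open>x\<close>, \<open>y\<close> of \<open>\<mu>\<close> produce an atom of \<open>\<theta>\<close> at \<open>d x y\<close>
  (\<open>distance_distribution_atom\<close>).  Since \<open>\<theta>'\<close> is non-atomic, the only possible atom of \<open>\<theta>\<close>
  is \<open>0\<close>, so \<open>\<mu>\<close> has a single atom and is a Dirac mass.  But then \<open>\<theta> = \<delta>\<^sub>0\<close>, whereas \<open>\<theta>\<close> gives
  \<open>0\<close> the mass \<open>p < 1\<close>.
\<close>

lemma singleton_in_metric_borel:
  assumes M: "Metric_space S d" and "x \<in> S"
  shows "{x} \<in> sets (metric_borel S d)"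
proof -
  interpret Metric_space S d by fact
  have "openin mtopology (S - {x})"
    using closedin_Hausdorff_singleton[OF Hausdorff_space_mtopology, of x] \<open>x \<in> S\<close>
    by (simp add: closedin_def)
  then have "S - {x} \<in> sets (metric_borel S d)"
    by (rule openin_metric_borel[OF M])
  from sets.compl_sets[OF this] show ?thesis
    using \<open>x \<in> S\<close> by (simp add: space_metric_borel[OF M] double_diff)
qed

text \<open>
  On a separable space a measure is concentrated on its support: among the balls of radius
  \<open>r / 2\<close> around a countable dense set, the null ones have a null union.  A point outside of this
  union lies in one of the remaining balls, and the \<open>r\<close>-ball around the point contains it.
\<close>

lemma AE_mball_positive:
  assumes M: "Metric_space S d"
    and sep: "separable_space (Metric_space.mtopology S d)"
    and \<mu>: "sets \<mu> = sets (metric_borel S d)"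
    and "0 < r"
  shows "AE x in \<mu>. 0 < emeasure \<mu> (Metric_space.mball S d x r)"
proof -
  interpret Metric_space S d by fact
  have ball: "mball c s \<in> sets \<mu>" for c s
    using openin_metric_borel[OF M] \<mu> by simp
  have sp: "space \<mu> = S"
    using sets_eq_imp_space_eq[OF \<mu>] by (simp add: space_metric_borel[OF M])
  obtain C where C: "countable C" "C \<subseteq> S" "mtopology closure_of C = S"
    using sep by (auto simp: separable_space_def)
  have "AE x in \<mu>. \<forall>c\<in>C. emeasure \<mu> (mball c (r/2)) = 0 \<longrightarrow> x \<notin> mball c (r/2)"
    unfolding AE_ball_countable[OF C(1)]
  proof
    fix c
    show "AE x in \<mu>. emeasure \<mu> (mball c (r/2)) = 0 \<longrightarrow> x \<notin> mball c (r/2)"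
      using AE_not_in[of "mball c (r/2)" \<mu>] ball[of c "r/2"]
      by (cases "emeasure \<mu> (mball c (r/2)) = 0") (simp_all only: null_setsI simp_thms eventually_True)
  qed
  then show ?thesis
  proof (rule AE_mp, intro AE_I2 impI)
    fix x assume "x \<in> space \<mu>"
      and x: "\<forall>c\<in>C. emeasure \<mu> (mball c (r/2)) = 0 \<longrightarrow> x \<notin> mball c (r/2)"
    then have "x \<in> S" by (simp add: sp)
    then have "\<forall>s>0. \<exists>c\<in>C. d x c < s"
      using C(3) by (auto simp: metric_closure_of set_eq_iff in_mball)
    then obtain c where c: "c \<in> C" "d x c < r/2"
      using half_gt_zero[OF \<open>0 < r\<close>] by blast
    have "x \<in> mball c (r/2)"
      using c C(2) \<open>x \<in> S\<close> by (auto simp: in_mball commute)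
    then have "0 < emeasure \<mu> (mball c (r/2))"
      using x c(1) by (auto simp: zero_less_iff_neq_zero)
    moreover have "mball c (r/2) \<subseteq> mball x r"
    proof
      fix y assume y: "y \<in> mball c (r/2)"
      then have "d x y \<le> d x c + d c y"
        using \<open>x \<in> S\<close> by (intro triangle) auto
      then show "y \<in> mball x r"
        using y c \<open>x \<in> S\<close> by (auto simp: in_mball)
    qed
    ultimately show "0 < emeasure \<mu> (mball x r)"
      using emeasure_mono[OF _ ball] by (meson order_less_le_trans)
  qed
qed

text \<open>
  By Fubini, for almost every \<open>x\<close> the punctured ball of radius \<open>r\<close> around \<open>x\<close> is null, so that
  all the mass of the ball, which is positive almost everywhere, sits at \<open>x\<close>.
\<close>

lemma AE_atom_if_distance_gap:
  assumes M: "Metric_space S d"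
    and sep: "separable_space (Metric_space.mtopology S d)"
    and \<mu>: "sets \<mu> = sets (metric_borel S d)"
    and "sigma_finite_measure \<mu>"
    and "0 < r"
    and gap: "AE (x, y) in \<mu> \<Otimes>\<^sub>M \<mu>. d x y = 0 \<or> r \<le> d x y"
  shows "AE x in \<mu>. 0 < emeasure \<mu> {x}"
proof -
  interpret Metric_space S d by fact
  interpret \<mu>: sigma_finite_measure \<mu> by fact
  interpret \<mu>\<mu>: pair_sigma_finite \<mu> \<mu> ..
  have sp: "space \<mu> = S"
    using sets_eq_imp_space_eq[OF \<mu>] by (simp add: space_metric_borel[OF M])
  have "AE x in \<mu>. AE y in \<mu>. d x y = 0 \<or> r \<le> d x y"
    using \<mu>\<mu>.AE_pair[OF gap] by simp
  with AE_mball_positive[OF M sep \<mu> \<open>0 < r\<close>] AE_space[of \<mu>] show ?thesis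
  proof eventually_elim
    fix x
    assume pos: "0 < emeasure \<mu> (mball x r)" and "x \<in> space \<mu>"
      and far: "AE y in \<mu>. d x y = 0 \<or> r \<le> d x y"
    then have "x \<in> S" by (simp add: sp)
    have "AE y in \<mu>. y \<in> mball x r \<longleftrightarrow> y \<in> {x}"
      using far AE_space[of \<mu>]
    proof eventually_elim
      fix y assume "d x y = 0 \<or> r \<le> d x y" "y \<in> space \<mu>"
      then show "y \<in> mball x r \<longleftrightarrow> y \<in> {x}"
        using \<open>x \<in> S\<close> \<open>0 < r\<close> by (auto simp: in_mball sp)
    qed
    then have "emeasure \<mu> (mball x r) = emeasure \<mu> {x}"
      using openin_metric_borel[OF M] singleton_in_metric_borel[OF M \<open>x \<in> S\<close>] \<mu>
      by (intro emeasure_eq_AE) auto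
    with pos show "0 < emeasure \<mu> {x}" by simp
  qed
qed

lemma measurable_distance:
  assumes "polish_metric S d" and "sets \<mu> = sets (metric_borel S d)"
  shows "(\<lambda>(x, y). d x y) \<in> \<mu> \<Otimes>\<^sub>M \<mu> \<rightarrow>\<^sub>M nonneg_borel"
  using measurable_metric[OF assms(1)]
    measurable_cong_sets[OF sets_pair_measure_cong[OF assms(2) assms(2)] refl]
  by blast

lemma space_nonneg_borel: "space nonneg_borel = {0..}"
  by (simp add: nonneg_borel_def space_restrict_space)

lemma sets_nonneg_borel_iff: "A \<in> sets nonneg_borel \<longleftrightarrow> A \<in> sets borel \<and> A \<subseteq> {0..}"
  by (auto simp: nonneg_borel_def sets_restrict_space_iff)

lemma distance_distribution_atom:
  assumes P: "polish_metric S d" and \<mu>: "sets \<mu> = sets (metric_borel S d)"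
    and "sigma_finite_measure \<mu>"
    and x: "x \<in> S" and y: "y \<in> S"
  shows "emeasure \<mu> {x} * emeasure \<mu> {y} \<le> emeasure (distance_distribution d \<mu>) {d x y}"
proof -
  have M: "Metric_space S d"
    using P by (simp add: polish_metric_def)
  interpret Metric_space S d by fact
  interpret \<mu>: sigma_finite_measure \<mu> by fact
  note meas = measurable_distance[OF P \<mu>]
  have sing: "{x} \<in> sets \<mu>" "{y} \<in> sets \<mu>"
    using singleton_in_metric_borel[OF M] x y \<mu> by auto
  have t: "{d x y} \<in> sets nonneg_borel"
    by (simp add: sets_nonneg_borel_iff)
  let ?D = "(\<lambda>(x, y). d x y) -` {d x y} \<inter> space (\<mu> \<Otimes>\<^sub>M \<mu>)"
  have "emeasure \<mu> {x} * emeasure \<mu> {y} = emeasure (\<mu> \<Otimes>\<^sub>M \<mu>) ({x} \<times> {y})"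
    by (rule \<mu>.emeasure_pair_measure_Times[OF sing, symmetric])
  also have "\<dots> \<le> emeasure (\<mu> \<Otimes>\<^sub>M \<mu>) ?D"
    using sing[THEN sets.sets_into_space] measurable_sets[OF meas t]
    by (intro emeasure_mono) (auto simp: space_pair_measure)
  also have "\<dots> = emeasure (distance_distribution d \<mu>) {d x y}"
    unfolding distance_distribution_def by (rule emeasure_distr[OF meas t, symmetric])
  finally show ?thesis .
qed

text \<open>
  Almost every point is an atom because of the gap above \<open>0\<close>, and two distinct atoms would be
  at a positive distance \<open>t\<close> with \<open>\<theta>{t} > 0\<close>.  So \<open>\<mu>\<close> is a Dirac mass, and the distance vanishes
  almost surely.
\<close>

lemma feasible_gap_imp_dirac:
  assumes "feasible TYPE('a) \<theta>"
    and "0 < r" and gap: "AE t in \<theta>. t = 0 \<or> r \<le> t"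
    and no_atom: "\<And>t. 0 < t \<Longrightarrow> emeasure \<theta> {t} = 0"
  shows "1 \<le> emeasure \<theta> {0}"
proof -
  obtain S :: "'a set" and d \<mu> where P: "polish_metric S d" and "prob_space \<mu>"
    and \<mu>: "sets \<mu> = sets (metric_borel S d)" and \<theta>: "distance_distribution d \<mu> = \<theta>"
    using assms(1) by (auto simp: feasible_def)
  have M: "Metric_space S d" and sep: "separable_space (Metric_space.mtopology S d)"
    using P by (auto simp: polish_metric_def)
  interpret Metric_space S d by fact
  interpret \<mu>: prob_space \<mu> by fact
  note sf = \<mu>.sigma_finite_measure_axioms
  have sp: "space \<mu> = S"
    using sets_eq_imp_space_eq[OF \<mu>] by (simp add: space_metric_borel[OF M])
  have "AE w in \<mu> \<Otimes>\<^sub>M \<mu>. (\<lambda>t. t = 0 \<or> r \<le> t) ((\<lambda>(x, y). d x y) w)"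
    using gap unfolding \<theta>[symmetric] distance_distribution_def
    by (rule AE_distrD[OF measurable_distance[OF P \<mu>]])
  then have "AE (x, y) in \<mu> \<Otimes>\<^sub>M \<mu>. d x y = 0 \<or> r \<le> d x y"
    by (simp add: case_prod_beta)
  then have AE_atom: "AE x in \<mu>. x \<in> S \<and> 0 < emeasure \<mu> {x}"
    using AE_atom_if_distance_gap[OF M sep \<mu> sf \<open>0 < r\<close>] AE_space[of \<mu>] by (auto simp: sp)
  then have "\<exists>a. a \<in> S \<and> 0 < emeasure \<mu> {a}"
    using eventually_happens[OF AE_atom] \<mu>.AE_False by (metis trivial_limit_def)
  then obtain a where a: "a \<in> S" "0 < emeasure \<mu> {a}" by blast
  have unique: "x = a" if x: "x \<in> S" "0 < emeasure \<mu> {x}" for x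
  proof (rule ccontr)
    assume "x \<noteq> a"
    then have "0 < d x a"
      using x(1) a(1) by simp
    have "emeasure \<mu> {x} * emeasure \<mu> {a} \<le> emeasure \<theta> {d x a}"
      using distance_distribution_atom[OF P \<mu> sf x(1) a(1)] by (simp add: \<theta>)
    also have "\<dots> = 0"
      by (rule no_atom) fact
    finally show False
      using x(2) a(2) by auto
  qed
  have "AE x in \<mu>. x \<in> {a}"
    using AE_atom by eventually_elim (auto dest: unique)
  then have "emeasure \<mu> {a} = 1"
    using singleton_in_metric_borel[OF M a(1)] \<mu> by (intro \<mu>.emeasure_eq_1_AE) auto
  then show ?thesis
    using distance_distribution_atom[OF P \<mu> sf a(1) a(1)] a(1) by (simp add: \<theta>)
qed

theorem proposition4:
  fixes p :: real and \<theta>' :: "real measure"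
  assumes "0 < p" and "p < 1"
    and "nonneg_distribution \<theta>'"
    and "nonatomic \<theta>'"
    and "0 \<notin> msupport \<theta>'"
  shows "\<not> feasible TYPE('a) (mixture p (return nonneg_borel 0) \<theta>')"
proof
  let ?\<theta> = "mixture p (return nonneg_borel 0) \<theta>'"
  assume feasible: "feasible TYPE('a) ?\<theta>"
  have sets: "sets \<theta>' = sets nonneg_borel"
    using assms(3) by (simp add: nonneg_distribution_def)
  then have sp: "space \<theta>' = {0..}"
    using sets_eq_imp_space_eq[OF sets] by (simp add: space_nonneg_borel)
  have \<theta>: "emeasure ?\<theta> A = ennreal p * indicator A 0 + ennreal (1 - p) * emeasure \<theta>' A"
    if "A \<in> sets nonneg_borel" for A
    using that by (subst emeasure_mixture) (auto simp: sets)
  have point: "emeasure ?\<theta> {t} = ennreal p * indicator {t} 0" if "0 \<le> t" for t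
    using that assms(4) by (subst \<theta>) (auto simp: sets_nonneg_borel_iff nonatomic_def sp)
  obtain U where U: "open U" "0 \<in> U" "emeasure \<theta>' (U \<inter> {0..}) = 0"
    using assms(5) by (auto simp: msupport_def sp zero_less_iff_neq_zero)
  obtain r where r: "0 < r" "ball 0 r \<subseteq> U"
    using U openE by blast
  have "AE t in ?\<theta>. t = 0 \<or> r \<le> t"
  proof (rule AE_I)
    show "{t \<in> space ?\<theta>. \<not> (t = 0 \<or> r \<le> t)} \<subseteq> U \<inter> {0<..}"
      using r(2) by (auto simp: space_nonneg_borel subset_iff dist_real_def)
    show "U \<inter> {0<..} \<in> sets ?\<theta>"
      using U(1) by (auto simp: sets_nonneg_borel_iff)
    have "emeasure \<theta>' (U \<inter> {0<..}) \<le> emeasure \<theta>' (U \<inter> {0..})"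
      using U(1) by (intro emeasure_mono) (auto simp: sets sets_nonneg_borel_iff)
    then show "emeasure ?\<theta> (U \<inter> {0<..}) = 0"
      using U by (subst \<theta>) (auto simp: sets_nonneg_borel_iff)
  qed
  then have "1 \<le> emeasure ?\<theta> {0}"
    using feasible r(1) point by (intro feasible_gap_imp_dirac) auto
  then have "1 \<le> ennreal p"
    by (simp add: point)
  with assms(1,2) show False
    by simp
qed

end
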